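(* For any connected graph $G$ of order $n\ge 2$ and for any positive integer $k$, $$\max\{\gamma_k(G),\dim_k(G)\}\le \gamma_L^k(G)\le \min\{1+\dim_k(G),\,n-1\}.$$
   Context: All graphs are finite, simple, undirected and connected. $d(x,y)$ is the length of a shortest path between $x$ and $y$ in $G$. For a positive integer $k$, let $d_k(x,y)=\min\{d(x,y),k+1\}$. A set $D\subseteq V(G)$ is a distance-$k$ dominating set of $G$ if for each $u\in V(G)\setminus D$ there is $w\in D$ with $d(u,w)\le k$; the distance-$k$ domination number $\gamma_k(G)$ is the minimum cardinality of a distance-$k$ dominating set. A set $S\subseteq V(G)$ is a distance-$k$ resolving set of $G$ if for any distinct $x,y\in V(G)$ there is $z\in S$ with $d_k(x,z)\ne d_k(y,z)$; the distance-$k$ dimension $\dim_k(G)$ is the minimum cardinality of a distance-$k$ resolving set. A distance-$k$ locating-dominating set of $G$ is a set $S\subseteq V(G)$ that is both a distance-$k$ dominating set and a distance-$k$ resolving set of $G$; the distance-$k$ location-domination number $\gamma_L^k(G)$ is the minimum cardinality of such a set. *)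

theory Defs
  imports "Graph_Theory.Digraph_Component" "Graph_Theory.Shortest_Path"
begin

text \<open>
  A finite simple undirected graph is a \<open>graph\<close> of \<open>Graph_Theory\<close>, i.e. a finite symmetric
  digraph without loops and parallel arcs; every edge is a pair of opposite arcs.
\<close>

definition graph_dist :: "('a, 'b) pre_digraph \<Rightarrow> 'a \<Rightarrow> 'a \<Rightarrow> nat" where
  "graph_dist G x y = (LEAST n. \<exists>p. pre_digraph.apath G x p y \<and> length p = n)"

lemma (in wf_digraph) graph_dist_eq_mu:
  assumes "x \<rightarrow>\<^sup>* y"
  shows "ereal (real (graph_dist G x y)) = \<mu> (\<lambda>_. 1) x y"
proof -
  have cost: "awalk_cost (\<lambda>_. 1) p = real (length p)" for p
    by (induction p) auto
  have short: "\<exists>p. apath x p y \<and> length p \<le> length q" if "awalk x q y" for q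
    using that
  proof (induction rule: awalk_to_apath_induct)
    case (path p)
    then show ?case by (auto simp: apath_def)
  next
    case (decomp p q r s)
    then have "length (q @ s) \<le> length p"
      by (auto elim: awalk_cyc_decompE)
    with decomp show ?case by (meson order_trans)
  qed
  obtain q where "awalk x q y"
    using assms by (auto simp: reachable_awalk)
  then have "\<exists>n p. apath x p y \<and> length p = n"
    using short by blast
  then have "\<exists>p. apath x p y \<and> length p = graph_dist G x y"
    unfolding graph_dist_def by (rule LeastI_ex)
  then obtain p where p: "apath x p y" "length p = graph_dist G x y"
    by blast
  have "graph_dist G x y \<le> length q" if q: "awalk x q y" for q
  proof -
    obtain p where p: "apath x p y" "length p \<le> length q"
      using short[OF q] by blast
    have "graph_dist G x y \<le> length p"
      unfolding graph_dist_def using p(1) by (intro Least_le) blast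
    with p(2) show ?thesis by simp
  qed
  then show ?thesis
    unfolding \<mu>_def cost using p awalkI_apath[OF p(1)]
    by (intro antisym INF_greatest INF_lower2[of p]) auto
qed

definition dist_k :: "('a, 'b) pre_digraph \<Rightarrow> nat \<Rightarrow> 'a \<Rightarrow> 'a \<Rightarrow> nat" where
  "dist_k G k x y = min (graph_dist G x y) (k + 1)"

definition dominating_k :: "('a, 'b) pre_digraph \<Rightarrow> nat \<Rightarrow> 'a set \<Rightarrow> bool" where
  "dominating_k G k D \<longleftrightarrow>
     D \<subseteq> verts G \<and> (\<forall>u \<in> verts G - D. \<exists>w \<in> D. graph_dist G u w \<le> k)"

definition resolving_k :: "('a, 'b) pre_digraph \<Rightarrow> nat \<Rightarrow> 'a set \<Rightarrow> bool" where
  "resolving_k G k S \<longleftrightarrow>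
     S \<subseteq> verts G \<and>
     (\<forall>x \<in> verts G. \<forall>y \<in> verts G. x \<noteq> y \<longrightarrow> (\<exists>z \<in> S. dist_k G k x z \<noteq> dist_k G k y z))"

definition locating_dominating_k :: "('a, 'b) pre_digraph \<Rightarrow> nat \<Rightarrow> 'a set \<Rightarrow> bool" where
  "locating_dominating_k G k S \<longleftrightarrow> dominating_k G k S \<and> resolving_k G k S"

definition domination_number_k :: "('a, 'b) pre_digraph \<Rightarrow> nat \<Rightarrow> nat" where
  "domination_number_k G k = (LEAST n. \<exists>D. dominating_k G k D \<and> card D = n)"

definition dim_k :: "('a, 'b) pre_digraph \<Rightarrow> nat \<Rightarrow> nat" where
  "dim_k G k = (LEAST n. \<exists>S. resolving_k G k S \<and> card S = n)"

definition location_domination_number_k :: "('a, 'b) pre_digraph \<Rightarrow> nat \<Rightarrow> nat" where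
  "location_domination_number_k G k = (LEAST n. \<exists>S. locating_dominating_k G k S \<and> card S = n)"

end

theory Submission
  imports Defs
begin

text \<open>
  The lower bound is immediate. For the upper bound, all vertices at distance more than \<open>k\<close> from
  a resolving set \<open>S\<close> have the same truncated distances \<open>k + 1\<close> to \<open>S\<close>, so there is at most one of
  them, and adding it to \<open>S\<close> gives a dominating set. Moreover, deleting a single vertex \<open>v\<close> from
  the vertex set leaves a locating-dominating set: \<open>v\<close> has a neighbour, and of two distinct
  vertices at least one remains and is the only vertex at distance \<open>0\<close> from itself.
\<close>

context wf_digraph
begin

lemma graph_dist_le_length:
  assumes "apath x p y"
  shows "graph_dist G x y \<le> length p"
  unfolding graph_dist_def using assms by (intro Least_le) blast

text \<open>Reachability makes the set of path lengths nonempty, so its least element is attained;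
  for an empty set \<open>LEAST\<close> would be unspecified.\<close>

lemma graph_dist_apath:
  assumes "x \<rightarrow>\<^sup>* y"
  obtains p where "apath x p y" "length p = graph_dist G x y"
proof -
  from assms obtain p where "apath x p y"
    by (auto simp: reachable_apath)
  then have "\<exists>n p. apath x p y \<and> length p = n"
    by blast
  then have "\<exists>p. apath x p y \<and> length p = graph_dist G x y"
    unfolding graph_dist_def by (rule LeastI_ex)
  with that show thesis by blast
qed

lemma graph_dist_self:
  assumes "x \<in> verts G"
  shows "graph_dist G x x = 0"
  using graph_dist_le_length[of x "[]" x] assms by (simp add: apath_Nil_iff)

lemma graph_dist_eq_0_iff:
  assumes "x \<rightarrow>\<^sup>* y"
  shows "graph_dist G x y = 0 \<longleftrightarrow> x = y"
proof
  assume "graph_dist G x y = 0"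
  with graph_dist_apath[OF assms] show "x = y"
    by (metis apath_Nil_iff length_0_conv)
next
  assume "x = y"
  with assms show "graph_dist G x y = 0"
    by (simp add: graph_dist_self reachable_in_verts)
qed

end

lemma resolving_k_mono:
  assumes "resolving_k G k S" "S \<subseteq> T" "T \<subseteq> verts G"
  shows "resolving_k G k T"
  using assms unfolding resolving_k_def by blast

lemma resolving_k_unique_undominated:
  assumes "resolving_k G k S" "x \<in> verts G" "y \<in> verts G"
    and "\<And>z. z \<in> S \<Longrightarrow> graph_dist G x z > k"
    and "\<And>z. z \<in> S \<Longrightarrow> graph_dist G y z > k"
  shows "x = y"
proof (rule ccontr)
  assume "x \<noteq> y"
  with assms(1-3) obtain z where "z \<in> S" "dist_k G k x z \<noteq> dist_k G k y z"
    unfolding resolving_k_def by blast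
  moreover from this(1) have "dist_k G k x z = k + 1" "dist_k G k y z = k + 1"
    using assms(4,5)[of z] by (simp_all add: dist_k_def)
  ultimately show False by simp
qed

lemma resolving_k_extend:
  assumes "resolving_k G k S"
  obtains T where "locating_dominating_k G k T" "card T \<le> 1 + card S"
proof (cases "dominating_k G k S")
  case True
  with assms that[of S] show thesis by (simp add: locating_dominating_k_def)
next
  case False
  have S: "S \<subseteq> verts G" using assms by (simp add: resolving_k_def)
  with False obtain u where u: "u \<in> verts G" "\<And>z. z \<in> S \<Longrightarrow> graph_dist G u z > k"
    unfolding dominating_k_def by (meson DiffD1 linorder_not_le)
  \<comment> \<open>A vertex \<open>x\<close> not dominated by \<open>insert u S\<close> would, like
    \<open>u\<close>, be farther than \<open>k\<close> from all of \<open>S\<close>, hence equal to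
    \<open>u\<close>.\<close>
  have "\<exists>w \<in> insert u S. graph_dist G x w \<le> k" if x: "x \<in> verts G - insert u S" for x
  proof (rule ccontr)
    assume "\<not> ?thesis"
    then have "x = u"
      using x u by (intro resolving_k_unique_undominated[OF assms]) (auto simp: not_le)
    with x show False by simp
  qed
  with S u(1) have "dominating_k G k (insert u S)"
    unfolding dominating_k_def by blast
  moreover have "resolving_k G k (insert u S)"
    using resolving_k_mono[OF assms] S u(1) by blast
  ultimately show thesis
    using that[of "insert u S"] card_insert_le_m1[of "1 + card S" S u]
    by (simp add: locating_dominating_k_def)
qed

lemma (in loopfree_digraph) locating_dominating_k_delete_vertex:
  assumes sc: "strongly_connected G" and k: "k \<ge> 1"
    and v: "v \<in> verts G" and w: "w \<in> verts G" "w \<noteq> v"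
  shows "locating_dominating_k G k (verts G - {v})"
  unfolding locating_dominating_k_def
proof
  have reach: "x \<rightarrow>\<^sup>* y" if "x \<in> verts G" "y \<in> verts G" for x y
    using sc that by (simp add: strongly_connected_def)
  \<comment> \<open>Only the first arc of this path matters: \<open>w \<noteq> v\<close> makes the
    path nonempty, and the head of its first arc is a neighbour of \<open>v\<close>, distinct from
    \<open>v\<close> as there are no loops.\<close>
  obtain p where p: "apath v p w"
    using reach[OF v w(1)] by (auto simp: reachable_apath)
  with w obtain e es where "p = e # es"
    by (cases p) (auto simp: apath_Nil_iff)
  with p have e: "e \<in> arcs G" "tail G e = v"
    by (simp_all add: apath_Cons_iff)
  then have head: "head G e \<in> verts G" "head G e \<noteq> v"
    using no_loops[of e] by auto
  with e have "apath v [e] (head G e)"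
    by (auto simp: apath_simps)
  from graph_dist_le_length[OF this] k have "graph_dist G v (head G e) \<le> k"
    by simp
  with head show "dominating_k G k (verts G - {v})"
    unfolding dominating_k_def by blast
  \<comment> \<open>The cap \<open>k + 1\<close> is positive, so truncation keeps zero and nonzero
    distances apart. Both orientations are stated because the resolving vertex is whichever of the
    two differs from \<open>v\<close>.\<close>
  have "dist_k G k x x \<noteq> dist_k G k y x" "dist_k G k y x \<noteq> dist_k G k x x"
    if "x \<in> verts G" "y \<in> verts G" "x \<noteq> y" for x y
    using that graph_dist_self[of x] graph_dist_eq_0_iff[OF reach, of y x]
    by (auto simp: dist_k_def)
  then show "resolving_k G k (verts G - {v})"
    unfolding resolving_k_def by (metis Diff_iff Diff_subset singletonD)
qed

theorem theorem3p1:
  fixes G :: "('a, 'b) pre_digraph" and n k :: nat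
  assumes "graph G"
    and "Digraph_Component.connected G"
    and "card (verts G) = n"
    and "n \<ge> 2"
    and "k \<ge> 1"
  shows "max (domination_number_k G k) (dim_k G k) \<le> location_domination_number_k G k
       \<and> location_domination_number_k G k \<le> min (1 + dim_k G k) (n - 1)"
proof -
  interpret graph G by fact
  \<comment> \<open>Connectivity refers to the symmetric closure; as the arcs are symmetric, it
    gives directed paths between all vertices.\<close>
  have sc: "strongly_connected G"
    using assms(2) by (intro symmetric_connected_imp_strongly_connected sym_arcs)
  have le: "location_domination_number_k G k \<le> card S" if "locating_dominating_k G k S" for S
    unfolding location_domination_number_k_def using that by (intro Least_le) blast
  have "\<not> is_singleton (verts G)" "verts G \<noteq> {}"
    using assms(3,4) by (auto simp: is_singleton_altdef)
  then obtain v w where vw: "v \<in> verts G" "w \<in> verts G" "w \<noteq> v"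
    by (metis ex_in_conv is_singletonI')
  have ld: "locating_dominating_k G k (verts G - {v})"
    using locating_dominating_k_delete_vertex[OF sc assms(5) vw] .
  have "location_domination_number_k G k \<le> n - 1"
    using le[OF ld] vw(1) assms(3) by simp
  moreover have "location_domination_number_k G k \<le> 1 + dim_k G k"
  proof -
    \<comment> \<open>The set from \<open>ld\<close> shows that resolving sets exist, so
      \<open>dim_k\<close> is attained by one, which can then be extended.\<close>
    have "\<exists>n S. resolving_k G k S \<and> card S = n"
      using ld by (auto simp: locating_dominating_k_def)
    then have "\<exists>S. resolving_k G k S \<and> card S = dim_k G k"
      unfolding dim_k_def by (rule LeastI_ex)
    then show ?thesis
      by (metis resolving_k_extend le order_trans)
  qed
  moreover have "domination_number_k G k \<le> location_domination_number_k G k"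
    and "dim_k G k \<le> location_domination_number_k G k"
  proof -
    \<comment> \<open>A minimum locating-dominating set is a candidate in both of the other
      minima.\<close>
    have "\<exists>n S. locating_dominating_k G k S \<and> card S = n"
      using ld by blast
    then have "\<exists>S. locating_dominating_k G k S \<and> card S = location_domination_number_k G k"
      unfolding location_domination_number_k_def by (rule LeastI_ex)
    then obtain S where "dominating_k G k S" "resolving_k G k S"
      and "card S = location_domination_number_k G k"
      by (auto simp: locating_dominating_k_def)
    then show "domination_number_k G k \<le> location_domination_number_k G k"
      and "dim_k G k \<le> location_domination_number_k G k"
      unfolding domination_number_k_def dim_k_def by (auto intro: Least_le)
  qed
  ultimately show ?thesis by simp
qed

end
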